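(* For all $d\geq 3$ and $X_1,X_2,X_3\in\mathscr{H}_d$, with $s_i:=\operatorname{trace}(D_\lambda^i)$, we have $$\mu_{\lambda,d}(X_1) =\frac{1}{q_{1,d}}\alpha_{(1)}\operatorname{trace}(X_1),$$ $$\mu_{\lambda,d}(X_1,X_2)= \frac{1}{q_{2,d}}\big(\alpha_{(1,1)}\operatorname{trace}(X_1)\operatorname{trace}(X_2)+\alpha_{(2)}\operatorname{trace}(X_1X_2)\big),$$ $$\begin{aligned}\mu_{\lambda,d}(X_1,X_2,X_3)=\frac{1}{q_{3,d}}\Big(& \alpha_{(1,1,1)}\operatorname{trace}(X_1)\operatorname{trace}(X_2)\operatorname{trace}(X_3)\\ &+\frac{\alpha_{(2,1)}}{3}\big(\operatorname{trace}(X_1)\operatorname{trace}(X_2X_3)+\operatorname{trace}(X_2)\operatorname{trace}(X_1X_3)+\operatorname{trace}(X_3)\operatorname{trace}(X_1X_2)\big)\\ &+\alpha_{(3)} \operatorname{trace}(X_1X_2X_3) \Big),\end{aligned}$$ where $$q_{1,d}=d,\qquad \alpha_{(1)}=s_1,$$ $$q_{2,d}=(d-1)d(d+2),\qquad \alpha_{(1,1)} =(d+1)s_1^2-2s_2,\qquad \alpha_{(2)} = -2s_1^2+2d s_2,$$ $$q_{3,d}= (d-2)(d-1)d(d+2)(d+4),$$ $$\alpha_{(1,1,1)} =(d^2+3d-2)s_1^3-6(d+2)s_1s_2+16s_3,$$ $$\alpha_{(2,1)} =-6(d+2)s_1^3 + 6(d^2+2d+4) s_1s_2-24ds_3,$$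 $$\alpha_{(3)} = 16s^3_1-24ds_1s_2+8d^2s_3.$$
   Context: $\mathscr{H}_d$ is the space of real symmetric $d\times d$ matrices with inner product $\langle X,Y\rangle=\operatorname{trace}(XY^* )$. $\lambda=(\lambda_1,\dots,\lambda_d)^*$ is a fixed vector with $1\ge\lambda_1\ge\dots\ge\lambda_k>\lambda_{k+1}=\dots=\lambda_d=0$ (with $1\le k<d$), $D_\lambda=\operatorname{diag}(\lambda_1,\dots,\lambda_d)$, and $\mathcal{G}_{\lambda,d}=\{OD_\lambda O^*:O\in\mathcal{O}(d)\}$, where $\mathcal{O}(d)$ is the orthogonal group. $\sigma_{\lambda,d}$ is the distribution of $OD_\lambda O^*$ with $O$ distributed according to normalized Haar measure on $\mathcal{O}(d)$. Cross-moments: $\mu_{\lambda,d}(X_1,\dots,X_t)=\int_{\mathcal{G}_{\lambda,d}}\langle X_1,P\rangle\cdots\langle X_t,P\rangle\,d\sigma_{\lambda,d}(P)$. *)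

theory Defs
  imports "HOL-Analysis.Analysis" "HOL-Probability.Probability_Measure"
begin

definition symmetric_matrices :: "(real^'n^'n) set" where
  "symmetric_matrices = {X. transpose X = X}"

definition matrix_inner :: "real^'n^'n \<Rightarrow> real^'n^'n \<Rightarrow> real" where
  "matrix_inner X Y = trace (X ** transpose Y)"

definition diag_matrix :: "real^'n \<Rightarrow> real^'n^'n" where
  "diag_matrix v = (\<chi> i j. if i = j then v $ i else 0)"

(* Type class multiplication, and hence (^), is entrywise on matrices;
   this is the power with respect to the matrix product. *)
primrec matrix_power :: "real^'n^'n \<Rightarrow> nat \<Rightarrow> real^'n^'n" where
  "matrix_power A 0 = mat 1"
| "matrix_power A (Suc m) = A ** matrix_power A m"

definition orthogonal_group :: "(real^'n^'n) set" where
  "orthogonal_group = {Q. orthogonal_matrix Q}"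

(* Normalized (left) Haar measure on the compact group O(d), characterised as the left-invariant
   Borel probability measure.  Regularity is automatic, O(d) being a compact metric space. *)
definition normalized_haar :: "(real^'n^'n) measure \<Rightarrow> bool" where
  "normalized_haar H \<longleftrightarrow>
     sets H = sets (restrict_space borel orthogonal_group) \<and>
     prob_space H \<and>
     (\<forall>U\<in>orthogonal_group. \<forall>A\<in>sets H. emeasure H ((\<lambda>Q. U ** Q) ` A) = emeasure H A)"

(* The position of i in the list of all indices in increasing order, counted from 1.  It identifies
   a finite linearly ordered index type of cardinality d with {1..d}. *)
definition position :: "'n::{finite,linorder} \<Rightarrow> nat" where
  "position i = card {j. j \<le> i}"

(* 1 \<ge> \<lambda>_1 \<ge> ... \<ge> \<lambda>_k > \<lambda>_{k+1} = ... = \<lambda>_d = 0  with  1 \<le> k < d *)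
definition admissible_spectrum :: "real^'n::{finite,linorder} \<Rightarrow> nat \<Rightarrow> bool" where
  "admissible_spectrum v k \<longleftrightarrow>
     1 \<le> k \<and> k < CARD('n) \<and>
     (\<forall>i. v $ i \<le> 1) \<and>
     (\<forall>i j. i \<le> j \<longrightarrow> v $ j \<le> v $ i) \<and>
     (\<forall>i. position i \<le> k \<longrightarrow> 0 < v $ i) \<and>
     (\<forall>i. k < position i \<longrightarrow> v $ i = 0)"

definition conj_orbit :: "real^'n \<Rightarrow> (real^'n^'n) set" where
  "conj_orbit v = {Q ** diag_matrix v ** transpose Q | Q. Q \<in> orthogonal_group}"

definition orbit_distr :: "(real^'n^'n) measure \<Rightarrow> real^'n \<Rightarrow> (real^'n^'n) measure" where
  "orbit_distr H v =
     distr H (restrict_space borel (conj_orbit v)) (\<lambda>Q. Q ** diag_matrix v ** transpose Q)"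

definition cross_moment :: "(real^'n^'n) measure \<Rightarrow> real^'n \<Rightarrow> (real^'n^'n) list \<Rightarrow> real" where
  "cross_moment H v Xs = (\<integral>P. (\<Prod>X\<leftarrow>Xs. matrix_inner X P) \<partial>orbit_distr H v)"

definition power_trace :: "real^'n \<Rightarrow> nat \<Rightarrow> real" where
  "power_trace v i = trace (matrix_power (diag_matrix v) i)"

end

theory Submission
  imports Defs
begin

text \<open>
The idea is that invariance determines the third moment up to three constants, that three known
expectations determine these constants, and that the lower moments are special cases of the third.

The third moment is a symmetric trilinear form in its arguments, and by left invariance of the
Haar measure it does not change when all arguments are conjugated by the same orthogonal matrix
(\<open>cross_moment_conj\<close>). By polarization (\<open>symmetric_triadditive_eqI\<close>) it is determined by its
values at triples \<open>(X, X, X)\<close>, and since symmetric matrices are orthogonally diagonalizable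
(\<open>orthogonal_diagonalization\<close>), by its values at diagonal \<open>X\<close>. On diagonal matrices it is a cubic
form in the eigenvalues. Conjugation by permutation matrices makes its coefficients invariant
under permutations of the indices, so that at most three different coefficients remain and the form
is a combination of \<open>(trace X)\<^sup>3\<close>, of \<open>trace X * trace (X ** X)\<close> and of \<open>trace (X ** X ** X)\<close>. Hence
the third moment is an \<open>invariant_trilinear\<close> form (\<open>third_moment_invariant_trilinear\<close>).

On the orbit the traces of \<open>P\<close>, \<open>P\<^sup>2\<close> and \<open>P\<^sup>3\<close> are the constants \<open>s1\<close>, \<open>s2\<close> and \<open>s3\<close>. Writing the
expectations of \<open>(trace P)\<^sup>3\<close>, of \<open>trace P * trace P\<^sup>2\<close> and of \<open>trace P\<^sup>3\<close> as sums of third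
moments gives three linear equations for the three coefficients (\<open>third_moment_equations\<close>). For
\<open>d \<ge> 3\<close> they have exactly one solution, the one in the theorem.

If one argument is the identity matrix, its inner product with \<open>P\<close> is the constant \<open>s1\<close>. As \<open>s1\<close> is
positive for an admissible spectrum, the second moment is the third one with an identity argument
divided by \<open>s1\<close>, and the first moment arises in the same way from the second.
\<close>

section \<open>Orthogonal diagonalization of symmetric matrices\<close>

lemma conj_nth: "(A ** Y ** transpose A) $ i $ j = A $ i \<bullet> (Y *v A $ j)"
  for A Y :: "real^'n^'n"
proof -
  have "(A ** Y ** transpose A) $ i $ j = (\<Sum>k\<in>UNIV. \<Sum>l\<in>UNIV. A $ i $ l * Y $ l $ k * A $ j $ k)"
    by (simp add: matrix_matrix_mult_def transpose_def sum_distrib_right)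
  also have "\<dots> = (\<Sum>l\<in>UNIV. \<Sum>k\<in>UNIV. A $ i $ l * Y $ l $ k * A $ j $ k)"
    by (rule sum.swap)
  finally show ?thesis
    by (simp add: inner_vec_def matrix_vector_mult_def sum_distrib_left mult.assoc)
qed

lemma inner_axis_matrix_axis: "axis i 1 \<bullet> (Y *v axis j 1) = Y $ i $ j" for Y :: "real^'n^'n"
  by (simp add: matrix_vector_mult_basis column_def inner_axis')

lemma matrix_inner_eq_sum: "matrix_inner X Y = (\<Sum>i\<in>UNIV. \<Sum>j\<in>UNIV. X $ i $ j * Y $ i $ j)"
  by (simp add: matrix_inner_def trace_def matrix_matrix_mult_def transpose_def)

lemma orthogonal_iff_rows: "orthogonal_matrix U \<longleftrightarrow> (\<forall>i j. U $ i \<bullet> U $ j = (if i = j then 1 else 0))"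
  for U :: "real^'n^'n"
proof -
  have "orthogonal_matrix U \<longleftrightarrow> U ** transpose U = mat 1"
    using orthogonal_matrix[of "transpose U"] by simp
  also have "\<dots> \<longleftrightarrow> (\<forall>i j. U $ i \<bullet> U $ j = (if i = j then 1 else 0))"
    by (simp add: vec_eq_iff matrix_matrix_mult_def transpose_def inner_vec_def mat_def)
  finally show ?thesis .
qed

text \<open>Compactness serves twice: the diagonalization below maximizes a continuous function over the
group, and every continuous function on the group is integrable for the Haar measure.\<close>

lemma compact_orthogonal_group: "compact (orthogonal_group :: (real^'n^'n) set)"
proof -
  have eq: "(orthogonal_group :: (real^'n^'n) set) =
     (\<Inter>i. \<Inter>j. {U. U $ i \<bullet> U $ j = (if i = j then 1 else 0)})"
    by (auto simp: orthogonal_group_def orthogonal_iff_rows)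
  have "closed (orthogonal_group :: (real^'n^'n) set)"
    unfolding eq
    by (intro closed_INT ballI closed_Collect_eq continuous_intros)
  moreover have "bounded (orthogonal_group :: (real^'n^'n) set)"
  proof (rule boundedI)
    fix U :: "real^'n^'n" assume "U \<in> orthogonal_group"
    then have "norm (U $ i) = 1" for i
      by (simp add: orthogonal_group_def orthogonal_iff_rows norm_eq_1)
    then show "norm U \<le> (\<Sum>i\<in>(UNIV::'n set). 1)"
      using L2_set_le_sum[of "UNIV :: 'n set" "\<lambda>i. norm (U $ i)"]
      unfolding norm_vec_def[of U] by simp
  qed
  ultimately show ?thesis by (simp add: compact_eq_bounded_closed)
qed

lemma conj_conj: "U ** (V ** Y ** transpose V) ** transpose U = (U ** V) ** Y ** transpose (U ** V)"
  for U V Y :: "real^'n^'n"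
  by (simp add: matrix_transpose_mul matrix_mul_assoc)

lemma transpose_conj: "transpose Y = Y \<Longrightarrow> transpose (U ** Y ** transpose U) = U ** Y ** transpose U"
  for U Y :: "real^'n^'n"
  by (simp add: matrix_transpose_mul matrix_mul_assoc)

text \<open>One step of the Jacobi eigenvalue method. A rotation in the plane of the axes \<open>p\<close> and \<open>q\<close>
alters only the diagonal entries at \<open>p\<close> and \<open>q\<close>. It keeps their sum \<open>a + b\<close> and, for the right
angle, turns their difference \<open>a - b\<close> into \<open>r = sqrt ((a - b)\<^sup>2 + 4 * y\<^sup>2)\<close>, where \<open>y\<close> is the
off-diagonal entry. Since \<open>2 * (a\<^sup>2 + b\<^sup>2) = (a + b)\<^sup>2 + (a - b)\<^sup>2\<close>, the sum of squares on the
diagonal grows by \<open>2 * y\<^sup>2\<close>.\<close>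

lemma Jacobi_step:
  fixes Y :: "real^'n^'n"
  assumes sym: "transpose Y = Y" and "p \<noteq> q" "Y $ p $ q \<noteq> 0"
  obtains U where "orthogonal_matrix U"
    "(\<Sum>i\<in>UNIV. (Y $ i $ i)^2) < (\<Sum>i\<in>UNIV. ((U ** Y ** transpose U) $ i $ i)^2)"
proof -
  define a b y where "a = Y $ p $ p" and "b = Y $ q $ q" and "y = Y $ p $ q"
  have yqp: "Y $ q $ p = y" using sym by (metis transpose_def vec_lambda_beta y_def)
  define r where "r = sqrt ((a - b)^2 + (2 * y)^2)"
  have r2: "r^2 = (a - b)^2 + (2 * y)^2" by (simp add: r_def)
  have "y \<noteq> 0" using assms by (simp add: y_def)
  then have "r > 0" by (simp add: r_def add_nonneg_pos)
  then have "((a - b) / r)^2 + (2 * y / r)^2 = 1"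
    using \<open>r > 0\<close>
    unfolding power_divide add_divide_distrib[symmetric] r2[symmetric] by simp
  \<comment> \<open>Twice the rotation angle: the angle of the planar vector \<open>(a - b, 2 * y)\<close>.\<close>
  then obtain t where t: "(a - b) / r = cos t" "2 * y / r = sin t"
    using sincos_total_2pi by metis
  define c s where "c = cos (t / 2)" and "s = sin (t / 2)"
  have cs: "c^2 + s^2 = 1" by (simp add: c_def s_def)
  have "cos t = c^2 - s^2" "sin t = 2 * s * c"
    using cos_double[of "t/2"] sin_double[of "t/2"] by (simp_all add: c_def s_def)
  moreover have "a - b = r * cos t" "2 * y = r * sin t"
    using \<open>r > 0\<close> by (simp_all flip: t)
  ultimately have ab: "a - b = r * (c^2 - s^2)" and yy: "y = r * (s * c)"
    by simp_all
  define U :: "real^'n^'n" where "U = (\<chi> i. if i = p then c *\<^sub>R axis p 1 + s *\<^sub>R axis q 1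
     else if i = q then - s *\<^sub>R axis p 1 + c *\<^sub>R axis q 1 else axis i 1)"
  have "orthogonal_matrix U"
    using cs \<open>p \<noteq> q\<close>
    by (auto simp: orthogonal_iff_rows U_def inner_add_left inner_add_right inner_axis_axis
        power2_eq_square algebra_simps)
  note lin = inner_add_left inner_add_right matrix_vector_right_distrib matrix_vector_mult_diff_distrib
    inner_diff_left inner_diff_right matrix_vector_mult_scaleR inner_axis_matrix_axis
  have dp: "(U ** Y ** transpose U) $ p $ p = c^2 * a + s^2 * b + 2 * (s * c) * y"
    using \<open>p \<noteq> q\<close> by (simp add: conj_nth U_def lin yqp a_def[symmetric] b_def[symmetric]
        y_def[symmetric] power2_eq_square algebra_simps)
  have dq: "(U ** Y ** transpose U) $ q $ q = s^2 * a + c^2 * b - 2 * (s * c) * y"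
    using \<open>p \<noteq> q\<close> by (simp add: conj_nth U_def lin yqp a_def[symmetric] b_def[symmetric]
        y_def[symmetric] power2_eq_square algebra_simps)
  have di: "(U ** Y ** transpose U) $ i $ i = Y $ i $ i" if "i \<noteq> p" "i \<noteq> q" for i
    using that by (simp add: conj_nth U_def inner_axis_matrix_axis)
  let ?p = "(U ** Y ** transpose U) $ p $ p" and ?q = "(U ** Y ** transpose U) $ q $ q"
  have sum: "?p + ?q = a + b"
  proof -
    have "?p + ?q = (c^2 + s^2) * (a + b)" unfolding dp dq by algebra
    then show ?thesis using cs by simp
  qed
  have diff: "?p - ?q = r"
  proof -
    have "?p - ?q = r * (c^2 - s^2)^2 + 4 * (s * c) * y"
      unfolding dp dq using ab by algebra
    also have "\<dots> = r * (c^2 + s^2)^2" unfolding yy by algebra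
    finally show ?thesis using cs by simp
  qed
  have "2 * (?p^2 + ?q^2) = (?p + ?q)^2 + (?p - ?q)^2" by algebra
  also have "\<dots> = 2 * (a^2 + b^2) + 4 * y^2"
    unfolding sum diff r2 by algebra
  finally have less: "a^2 + b^2 < ?p^2 + ?q^2"
    by (smt (verit) \<open>y \<noteq> 0\<close> zero_less_power2)
  have split: "(\<Sum>i\<in>UNIV. f i) = f p + f q + (\<Sum>i\<in>UNIV - {p, q}. f i)" for f :: "'n \<Rightarrow> real"
    using \<open>p \<noteq> q\<close> sum.subset_diff[of "{p, q}" UNIV f] by simp
  have "(\<Sum>i\<in>UNIV. (Y $ i $ i)^2) < (\<Sum>i\<in>UNIV. ((U ** Y ** transpose U) $ i $ i)^2)"
    unfolding split[of "\<lambda>i. (Y $ i $ i)^2"] split[of "\<lambda>i. ((U ** Y ** transpose U) $ i $ i)^2"]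
    using less by (simp add: di a_def b_def)
  then show ?thesis using that \<open>orthogonal_matrix U\<close> by blast
qed

text \<open>Among all conjugates of \<open>X\<close>, one maximizes the sum of the squared diagonal entries. A nonzero
off-diagonal entry of it would contradict \<open>Jacobi_step\<close>.\<close>

lemma orthogonal_diagonalization:
  fixes X :: "real^'n^'n"
  assumes sym: "transpose X = X"
  obtains U x where "orthogonal_matrix U" "U ** X ** transpose U = diag_matrix x"
proof -
  let ?g = "\<lambda>U :: real^'n^'n. \<Sum>i\<in>UNIV. ((U ** X ** transpose U) $ i $ i)^2"
  have "continuous_on orthogonal_group ?g"
    unfolding matrix_matrix_mult_def transpose_def by (simp, intro continuous_intros)
  moreover have "mat 1 \<in> (orthogonal_group :: (real^'n^'n) set)"
    by (simp add: orthogonal_group_def orthogonal_matrix_id)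
  ultimately have "\<exists>U\<in>orthogonal_group. \<forall>V\<in>orthogonal_group. ?g V \<le> ?g U"
    by (intro continuous_attains_sup[OF compact_orthogonal_group]) auto
  then obtain U where U: "U \<in> orthogonal_group" "\<And>V. V \<in> orthogonal_group \<Longrightarrow> ?g V \<le> ?g U"
    by blast
  define Y where "Y = U ** X ** transpose U"
  have symY: "transpose Y = Y" unfolding Y_def by (rule transpose_conj[OF sym])
  have "Y $ p $ q = 0" if "p \<noteq> q" for p q
  proof (rule ccontr)
    assume "Y $ p $ q \<noteq> 0"
    from Jacobi_step[OF symY that this] obtain V where V: "orthogonal_matrix V"
      "(\<Sum>i\<in>UNIV. (Y $ i $ i)^2) < (\<Sum>i\<in>UNIV. ((V ** Y ** transpose V) $ i $ i)^2)" .
    have "?g U < ?g (V ** U)" using V(2) by (simp add: Y_def conj_conj)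
    moreover have "V ** U \<in> orthogonal_group"
      using U V by (simp add: orthogonal_group_def orthogonal_matrix_mul)
    ultimately show False using U(2) by fastforce
  qed
  then have "Y = diag_matrix (\<chi> i. Y $ i $ i)" by (simp add: vec_eq_iff diag_matrix_def)
  then show ?thesis using that U by (simp add: orthogonal_group_def Y_def)
qed

section \<open>Moments of the orbit distribution\<close>

lemma normalized_haar_space: "normalized_haar H \<Longrightarrow> space H = orthogonal_group"
  unfolding normalized_haar_def by (metis Int_UNIV_right inf_commute sets_eq_imp_space_eq space_borel space_restrict_space)

lemma borel_measurable_haar:
  fixes f :: "real^'n^'n \<Rightarrow> 'b::topological_space"
  assumes "normalized_haar H" "continuous_on orthogonal_group f"
  shows "f \<in> borel_measurable H"
proof -
  have "sets H = sets (restrict_space borel orthogonal_group)"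
    using assms by (simp add: normalized_haar_def)
  with borel_measurable_continuous_on_restrict[OF assms(2)] show ?thesis
    using measurable_cong_sets by blast
qed

lemma integrable_haar:
  fixes f :: "real^'n^'n \<Rightarrow> real"
  assumes H: "normalized_haar H" and f: "continuous_on orthogonal_group f"
  shows "integrable H f"
proof -
  interpret prob_space H using H by (simp add: normalized_haar_def)
  have "bounded (f ` orthogonal_group)"
    using compact_continuous_image[OF f compact_orthogonal_group] compact_imp_bounded by blast
  then obtain B where "\<And>Q. Q \<in> orthogonal_group \<Longrightarrow> norm (f Q) \<le> B"
    unfolding bounded_iff by blast
  then show ?thesis
    by (intro integrable_const_bound[where B = B] AE_I2 borel_measurable_haar[OF H f])
       (simp add: normalized_haar_space[OF H])
qed

lemma orthogonal_group_mult: "U \<in> orthogonal_group \<Longrightarrow> V \<in> orthogonal_group \<Longrightarrow> U ** V \<in> orthogonal_group"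
  for U V :: "real^'n^'n"
  by (simp add: orthogonal_group_def orthogonal_matrix_mul)

text \<open>Left invariance is stated for images of sets under translations; pushing the measure forward
needs preimages, which are images under the inverse translation.\<close>

lemma integral_haar_translate:
  fixes f :: "real^'n^'n \<Rightarrow> real"
  assumes H: "normalized_haar H" and U: "U \<in> orthogonal_group"
    and f: "continuous_on orthogonal_group f"
  shows "(\<integral>Q. f (U ** Q) \<partial>H) = (\<integral>Q. f Q \<partial>H)"
proof -
  note [simp] = normalized_haar_space[OF H]
  have setsH: "sets H = sets (restrict_space borel orthogonal_group)"
    using H by (simp add: normalized_haar_def)
  have Ut: "transpose U \<in> orthogonal_group" and inv: "transpose U ** U = mat 1" "U ** transpose U = mat 1"
    using U by (simp_all add: orthogonal_group_def orthogonal_matrix_def)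
  have "continuous_on orthogonal_group ((**) U)"
    unfolding matrix_matrix_mult_def by (intro continuous_intros)
  then have "(**) U \<in> borel_measurable H" by (rule borel_measurable_haar[OF H])
  then have "(**) U \<in> H \<rightarrow>\<^sub>M restrict_space borel orthogonal_group"
    by (rule measurable_restrict_space2[rotated]) (auto intro: orthogonal_group_mult U)
  then have meas: "(**) U \<in> H \<rightarrow>\<^sub>M H"
    using measurable_cong_sets[OF refl setsH] by blast
  have "distr H H ((**) U) = H"
  proof (rule measure_eqI)
    fix A assume "A \<in> sets (distr H H ((**) U))"
    then have A: "A \<in> sets H" by simp
    then have sub: "A \<subseteq> orthogonal_group" using sets.sets_into_space by fastforce
    have "(**) U -` A \<inter> space H = (**) (transpose U) ` A"
    proof (intro equalityI subsetI)
      fix Q assume "Q \<in> (**) U -` A \<inter> space H"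
      then have "U ** Q \<in> A" "Q = transpose U ** (U ** Q)"
        by (simp_all add: matrix_mul_assoc inv)
      then show "Q \<in> (**) (transpose U) ` A" by blast
    next
      fix Q assume "Q \<in> (**) (transpose U) ` A"
      then show "Q \<in> (**) U -` A \<inter> space H"
        using sub Ut by (auto simp: matrix_mul_assoc inv intro: orthogonal_group_mult)
    qed
    then show "emeasure (distr H H ((**) U)) A = emeasure H A"
      using H Ut A by (simp add: emeasure_distr[OF meas A] normalized_haar_def)
  qed simp
  then have "(\<integral>Q. f Q \<partial>H) = (\<integral>Q. f Q \<partial>distr H H ((**) U))" by simp
  also have "\<dots> = (\<integral>Q. f (U ** Q) \<partial>H)"
    by (rule integral_distr[OF meas borel_measurable_haar[OF H f]])
  finally show ?thesis by simp
qed

lemma continuous_on_matrix_inner_conj: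
  "continuous_on S (\<lambda>Q. matrix_inner X (Q ** Y ** transpose Q))" for X Y :: "real^'n^'n"
  unfolding matrix_inner_eq_sum matrix_matrix_mult_def transpose_def
  by (simp, intro continuous_intros)

lemma continuous_on_prod_list_matrix_inner_conj:
  "continuous_on S (\<lambda>Q. \<Prod>X\<leftarrow>Xs. matrix_inner X (Q ** Y ** transpose Q))" for Y :: "real^'n^'n" and Xs :: "(real^'n^'n) list"
  by (induction Xs) (auto intro!: continuous_on_mult continuous_on_matrix_inner_conj)

lemma cross_moment_eq_haar_integral:
  assumes H: "normalized_haar H"
  shows "cross_moment H v Xs =
    (\<integral>Q. (\<Prod>X\<leftarrow>Xs. matrix_inner X (Q ** diag_matrix v ** transpose Q)) \<partial>H)"
  unfolding cross_moment_def orbit_distr_def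
proof (rule integral_distr)
  have "continuous_on orthogonal_group (\<lambda>Q. Q ** diag_matrix v ** transpose Q)"
    unfolding matrix_matrix_mult_def transpose_def by (simp, intro continuous_intros)
  then show "(\<lambda>Q. Q ** diag_matrix v ** transpose Q) \<in> H \<rightarrow>\<^sub>M restrict_space borel (conj_orbit v)"
    by (intro measurable_restrict_space2 borel_measurable_haar[OF H])
       (auto simp: conj_orbit_def normalized_haar_space[OF H])
  have "continuous_on UNIV (\<lambda>P. \<Prod>X\<leftarrow>Xs. matrix_inner X P)"
    by (induction Xs) (auto simp: matrix_inner_eq_sum intro!: continuous_intros)
  then show "(\<lambda>P. \<Prod>X\<leftarrow>Xs. matrix_inner X P) \<in> borel_measurable (restrict_space borel (conj_orbit v))"
    by (intro measurable_restrict_space1 borel_measurable_continuous_onI)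
qed

lemma integrable_cross_moment:
  assumes "normalized_haar H"
  shows "integrable H (\<lambda>Q. \<Prod>X\<leftarrow>Xs. matrix_inner X (Q ** diag_matrix v ** transpose Q))"
  by (intro integrable_haar assms continuous_on_prod_list_matrix_inner_conj)

lemma matrix_inner_conj:
  "matrix_inner (transpose U ** X ** U) P = matrix_inner X (U ** P ** transpose U)"
  for U X P :: "real^'n^'n"
proof -
  have "trace (transpose U ** X ** U ** transpose P) = trace (X ** U ** transpose P ** transpose U)"
    using trace_mul_sym[of "transpose U" "X ** U ** transpose P"] by (simp add: matrix_mul_assoc)
  then show ?thesis by (simp add: matrix_inner_def matrix_transpose_mul matrix_mul_assoc)
qed

text \<open>Conjugating every argument by \<open>U\<close> amounts to replacing \<open>Q\<close> by \<open>transpose U ** Q\<close> under the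
integral, so this is the invariance of the Haar measure.\<close>

lemma cross_moment_conj:
  assumes H: "normalized_haar H" and U: "orthogonal_matrix U"
  shows "cross_moment H v (map (\<lambda>X. U ** X ** transpose U) Xs) = cross_moment H v Xs"
proof -
  have eq: "matrix_inner (U ** X ** transpose U) (Q ** diag_matrix v ** transpose Q) =
      matrix_inner X ((transpose U ** Q) ** diag_matrix v ** transpose (transpose U ** Q))" for X Q
    using matrix_inner_conj[of "transpose U" X]
    by (simp add: matrix_transpose_mul matrix_mul_assoc)
  show ?thesis
    unfolding cross_moment_eq_haar_integral[OF H] list.map_comp o_def eq
    by (rule integral_haar_translate[OF H])
       (use U in \<open>simp_all add: orthogonal_group_def continuous_on_prod_list_matrix_inner_conj\<close>)
qed

lemma cross_moment_perm:
  assumes "normalized_haar H" "mset Xs = mset Ys"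
  shows "cross_moment H v Xs = cross_moment H v Ys"
  unfolding cross_moment_eq_haar_integral[OF assms(1)]
  using assms(2) by (simp add: prod_mset_prod_list[symmetric])

lemma matrix_inner_add: "matrix_inner (X + Y) P = matrix_inner X P + matrix_inner Y P"
  by (simp add: matrix_inner_eq_sum distrib_right sum.distrib)

lemma cross_moment_add:
  assumes "normalized_haar H"
  shows "cross_moment H v ((X + Y) # Xs) = cross_moment H v (X # Xs) + cross_moment H v (Y # Xs)"
  using integrable_cross_moment[OF assms, of v "X # Xs"] integrable_cross_moment[OF assms, of v "Y # Xs"]
  by (simp add: cross_moment_eq_haar_integral[OF assms] matrix_inner_add distrib_right)

text \<open>A linear relation between products of inner products that holds at every point of the orbit
passes to the moments. This is how the traces of \<open>P\<close>, \<open>P\<^sup>2\<close> and \<open>P\<^sup>3\<close>, which are constant on the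
orbit, enter the computation.\<close>

lemma cross_moment_linear_relation:
  assumes H: "normalized_haar H" and I: "finite I"
    and rel: "\<And>P. P \<in> conj_orbit v \<Longrightarrow>
      (\<Sum>i\<in>I. w i * (\<Prod>X\<leftarrow>L i. matrix_inner X P)) = c * (\<Prod>X\<leftarrow>Ys. matrix_inner X P)"
  shows "(\<Sum>i\<in>I. w i * cross_moment H v (L i)) = c * cross_moment H v Ys"
proof -
  let ?P = "\<lambda>Q. Q ** diag_matrix v ** transpose Q"
  have "(\<Sum>i\<in>I. w i * cross_moment H v (L i)) =
    (\<integral>Q. (\<Sum>i\<in>I. w i * (\<Prod>X\<leftarrow>L i. matrix_inner X (?P Q))) \<partial>H)"
    using integrable_cross_moment[OF H]
    by (simp add: cross_moment_eq_haar_integral[OF H] Bochner_Integration.integral_sum)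
  also have "\<dots> = (\<integral>Q. c * (\<Prod>X\<leftarrow>Ys. matrix_inner X (?P Q)) \<partial>H)"
  proof (rule Bochner_Integration.integral_cong[OF refl])
    fix Q assume "Q \<in> space H"
    then have "?P Q \<in> conj_orbit v" using H by (auto simp: conj_orbit_def normalized_haar_space)
    then show "(\<Sum>i\<in>I. w i * (\<Prod>X\<leftarrow>L i. matrix_inner X (?P Q))) = c * (\<Prod>X\<leftarrow>Ys. matrix_inner X (?P Q))"
      by (rule rel)
  qed
  finally show ?thesis by (simp add: cross_moment_eq_haar_integral[OF H])
qed

lemma cross_moment_Nil: "normalized_haar H \<Longrightarrow> cross_moment H v [] = 1"
  using prob_space.prob_space[of H]
  by (simp add: cross_moment_eq_haar_integral normalized_haar_def)

lemma diag_matrix_mult: "diag_matrix x ** diag_matrix y = diag_matrix (\<chi> i. x $ i * y $ i)"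
proof -
  have "(if i = k then x $ i else 0) * (if k = j then y $ k else 0) =
      (if k = i then if i = j then x $ i * y $ i else 0 else 0)" for i j k
    by auto
  then show ?thesis by (simp add: vec_eq_iff matrix_matrix_mult_def diag_matrix_def)
qed

lemma trace_diag_matrix: "trace (diag_matrix x) = (\<Sum>i\<in>UNIV. x $ i)"
  by (simp add: trace_def diag_matrix_def)

lemma trace_transpose: "trace (transpose A) = trace A"
  by (simp add: trace_def transpose_def)

lemma trace_conj:
  fixes A U :: "real^'n^'n"
  assumes "orthogonal_matrix U"
  shows "trace (U ** A ** transpose U) = trace A"
  using trace_mul_sym[of "U ** A" "transpose U"] assms
  by (simp add: matrix_mul_assoc orthogonal_matrix_def)

lemma conj_mult:
  fixes A B U :: "real^'n^'n"
  assumes "orthogonal_matrix U"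
  shows "(U ** A ** transpose U) ** (U ** B ** transpose U) = U ** (A ** B) ** transpose U"
proof -
  have "(U ** A ** transpose U) ** (U ** B ** transpose U) = U ** A ** (transpose U ** U) ** B ** transpose U"
    by (simp only: matrix_mul_assoc)
  also have "transpose U ** U = mat 1"
    using assms by (simp add: orthogonal_matrix_def)
  finally show ?thesis by (simp only: matrix_mul_rid matrix_mul_assoc)
qed

lemma conj_orbit_transpose: "P \<in> conj_orbit v \<Longrightarrow> transpose P = P"
  by (auto simp: conj_orbit_def intro!: transpose_conj)
     (auto simp: vec_eq_iff transpose_def diag_matrix_def)

lemma conj_orbit_traces:
  assumes "P \<in> conj_orbit v"
  shows "trace P = power_trace v 1" "trace (P ** P) = power_trace v 2"
    "trace (P ** P ** P) = power_trace v 3"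
proof -
  let ?D = "diag_matrix v"
  obtain Q where Q: "orthogonal_matrix Q" and P: "P = Q ** ?D ** transpose Q"
    using assms by (auto simp: conj_orbit_def orthogonal_group_def)
  have P2: "P ** P = Q ** (?D ** ?D) ** transpose Q"
    and P3: "P ** P ** P = Q ** (?D ** ?D ** ?D) ** transpose Q"
    by (simp_all only: P conj_mult[OF Q])
  show "trace P = power_trace v 1"
    by (simp add: P trace_conj[OF Q] power_trace_def)
  show "trace (P ** P) = power_trace v 2" "trace (P ** P ** P) = power_trace v 3"
    unfolding P3 unfolding P2 trace_conj[OF Q]
    by (simp_all add: power_trace_def numeral_2_eq_2 numeral_3_eq_3 matrix_mul_assoc)
qed

lemma matrix_inner_mat_1: "matrix_inner (mat 1) P = trace P"
  by (simp add: matrix_inner_def trace_transpose)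

text \<open>The inner product of the identity with \<open>P\<close> is the trace of \<open>P\<close>, a constant. An identity argument
thus lowers the degree of a moment, which later yields the first two moments from the third.\<close>

lemma cross_moment_mat_1_Cons:
  assumes "normalized_haar H"
  shows "cross_moment H v (mat 1 # Xs) = power_trace v 1 * cross_moment H v Xs"
proof -
  have "(\<Sum>i\<in>{()}. 1 * cross_moment H v (mat 1 # Xs)) = power_trace v 1 * cross_moment H v Xs"
    by (rule cross_moment_linear_relation[OF assms])
       (simp_all add: matrix_inner_mat_1 conj_orbit_traces(1)[of _ v])
  then show ?thesis by simp
qed

section \<open>Traces of the orbit points as sums of moments\<close>

text \<open>The symmetric part of a matrix unit: pairing with it reads off an entry of a symmetric matrix.\<close>

definition sym_unit :: "'n \<Rightarrow> 'n \<Rightarrow> real^'n^'n" where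
  "sym_unit i j = (\<chi> a b. (of_bool (a = i \<and> b = j) + of_bool (a = j \<and> b = i)) / 2)"

lemma sym_unit_nth:
  "sym_unit i j $ a $ b = (of_bool (a = i \<and> b = j) + of_bool (a = j \<and> b = i)) / 2"
  by (simp add: sym_unit_def)

lemma transpose_sym_unit: "transpose (sym_unit i j) = sym_unit i j"
  by (simp add: vec_eq_iff sym_unit_nth transpose_def add.commute conj_commute)

lemma matrix_inner_sym_unit: "matrix_inner (sym_unit i j) M = (M $ i $ j + M $ j $ i) / 2"
proof -
  have "(of_bool (a = i \<and> b = j) + of_bool (a = j \<and> b = i)) / 2 * M $ a $ b =
     (if a = i then if b = j then M $ a $ b else 0 else 0) / 2 + (if a = j then if b = i then M $ a $ b else 0 else 0) / 2"
    for a b by auto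
  then have "matrix_inner (sym_unit i j) M =
     (\<Sum>a\<in>UNIV. \<Sum>b\<in>UNIV. (if a = i then if b = j then M $ a $ b else 0 else 0) / 2
       + (if a = j then if b = i then M $ a $ b else 0 else 0) / 2)"
    unfolding matrix_inner_eq_sum sym_unit_def by (simp only: vec_lambda_beta)
  also have "\<dots> = (\<Sum>a\<in>UNIV. (if a = i then M $ i $ j / 2 else 0) + (if a = j then M $ j $ i / 2 else 0))"
    by (intro sum.cong refl) (auto simp: sum.distrib sum_divide_distrib[symmetric])
  finally show ?thesis by (simp add: sum.distrib add_divide_distrib)
qed

lemma matrix_inner_sym_unit_symmetric:
  "transpose P = P \<Longrightarrow> matrix_inner (sym_unit i j) P = P $ i $ j"
proof -
  assume "transpose P = P"
  then have "P $ j $ i = P $ i $ j"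
    by (metis transpose_def vec_lambda_beta)
  then show ?thesis by (simp add: matrix_inner_sym_unit)
qed

lemma sym_unit_mult_nth:
  "(sym_unit i j ** M) $ a $ b = (of_bool (a = i) * M $ j $ b + of_bool (a = j) * M $ i $ b) / 2"
proof -
  have "(of_bool (a = i \<and> c = j) + of_bool (a = j \<and> c = i)) / 2 * M $ c $ b =
     (if c = j then of_bool (a = i) * M $ c $ b / 2 else 0) + (if c = i then of_bool (a = j) * M $ c $ b / 2 else 0)"
    for c by auto
  then show ?thesis
    by (simp add: matrix_matrix_mult_def sym_unit_def sum.distrib add_divide_distrib)
qed

lemma trace_sym_unit: "trace (sym_unit i j) = of_bool (i = j)"
proof -
  have "trace (sym_unit i j) = matrix_inner (sym_unit i j) (mat 1)"
    by (simp add: matrix_inner_def)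
  also have "\<dots> = of_bool (i = j)"
    by (auto simp: matrix_inner_sym_unit mat_def)
  finally show ?thesis .
qed

lemma trace_mult_sym_unit: "trace (M ** sym_unit i j) = (M $ i $ j + M $ j $ i) / 2"
proof -
  have "trace (M ** sym_unit i j) = matrix_inner (sym_unit i j) (transpose M)"
    unfolding trace_mul_sym[of M] by (simp add: matrix_inner_def)
  then show ?thesis by (simp add: matrix_inner_sym_unit transpose_def)
qed

lemma trace_sym_unit_mult:
  "trace (sym_unit i j ** sym_unit k l) =
    (of_bool (k = i \<and> l = j) + of_bool (k = j \<and> l = i)) / 2"
proof -
  have "trace (sym_unit i j ** sym_unit k l) = sym_unit i j $ k $ l"
    unfolding trace_mul_sym[of "sym_unit i j"] using matrix_inner_sym_unit_symmetric[OF transpose_sym_unit]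
    by (metis matrix_inner_def transpose_sym_unit)
  then show ?thesis by (simp only: sym_unit_nth)
qed

text \<open>The value is written in terms of coincidences of indices, so that \<open>sum_coincidence_kernel\<close> with
unit weights gives the sum over all indices.\<close>

lemma trace_sym_unit_cycle:
  "trace (sym_unit i j ** sym_unit j k ** sym_unit k i) =
    (1 + of_bool (i = j) + of_bool (j = k) + of_bool (i = k) + 4 * of_bool (i = j \<and> j = k)) / 8"
proof -
  consider "i = j" "j = k" | "i = j" "j \<noteq> k" | "i = k" "i \<noteq> j" | "j = k" "i \<noteq> j"
    | "i \<noteq> j" "j \<noteq> k" "i \<noteq> k" by blast
  then show ?thesis
  proof cases
    case 1 show ?thesis
      unfolding trace_mult_sym_unit sym_unit_mult_nth sym_unit_nth using 1 by simp
  next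
    case 2 show ?thesis
      unfolding trace_mult_sym_unit sym_unit_mult_nth sym_unit_nth using 2 by simp
  next
    case 3 show ?thesis
      unfolding trace_mult_sym_unit sym_unit_mult_nth sym_unit_nth using 3 by simp
  next
    case 4 show ?thesis
      unfolding trace_mult_sym_unit sym_unit_mult_nth sym_unit_nth using 4 by simp
  next
    case 5 show ?thesis
      unfolding trace_mult_sym_unit sym_unit_mult_nth sym_unit_nth using 5 by simp
  qed
qed

lemma sum_pairs: "(\<Sum>(i, j)\<in>UNIV. f i j) = (\<Sum>i\<in>UNIV. \<Sum>j\<in>UNIV. f i j)"
  by (simp add: sum.cartesian_product)

lemma sum_triples: "(\<Sum>(i, j, k)\<in>UNIV. f i j k) = (\<Sum>i\<in>UNIV. \<Sum>j\<in>UNIV. \<Sum>k\<in>UNIV. f i j k)"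
proof -
  have "(\<Sum>(i, j, k)\<in>UNIV. f i j k) = (\<Sum>i\<in>UNIV. \<Sum>p\<in>UNIV. case p of (j, k) \<Rightarrow> f i j k)"
    by (rule sum_pairs)
  then show ?thesis by (simp only: sum_pairs)
qed

text \<open>At a symmetric \<open>P\<close> the integrands are \<open>P $ i $ j * P $ i $ j\<close>, and their sum is the trace of \<open>P\<^sup>2\<close>.\<close>

lemma sum_cross_moment_sym_unit2:
  assumes H: "normalized_haar H"
  shows "(\<Sum>i\<in>UNIV. \<Sum>j\<in>UNIV. cross_moment H v [sym_unit i j, sym_unit i j]) = power_trace v 2"
proof -
  let ?L = "\<lambda>(i, j). [sym_unit i j, sym_unit i j]"
  have "(\<Sum>p\<in>UNIV. 1 * cross_moment H v (?L p)) = power_trace v 2 * cross_moment H v []"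
  proof (rule cross_moment_linear_relation[OF H])
    fix P assume P: "P \<in> conj_orbit v"
    have entry: "matrix_inner (sym_unit i j) P = P $ i $ j" for i j
      using conj_orbit_transpose[OF P] by (rule matrix_inner_sym_unit_symmetric)
    have "(\<Sum>p\<in>UNIV. 1 * (\<Prod>X\<leftarrow>?L p. matrix_inner X P)) = (\<Sum>(i, j)\<in>UNIV. P $ i $ j * P $ i $ j)"
      by (intro sum.cong) (auto simp: entry)
    also have "\<dots> = trace (P ** P)"
      using conj_orbit_transpose[OF P] matrix_inner_eq_sum[of P P] by (simp add: sum_pairs matrix_inner_def)
    finally show "(\<Sum>p\<in>UNIV. 1 * (\<Prod>X\<leftarrow>?L p. matrix_inner X P)) =
        power_trace v 2 * (\<Prod>X\<leftarrow>[]. matrix_inner X P)"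
      by (simp add: conj_orbit_traces[OF P])
  qed simp
  moreover have "(\<Sum>p\<in>UNIV. 1 * cross_moment H v (?L p)) =
      (\<Sum>(i, j)\<in>UNIV. cross_moment H v [sym_unit i j, sym_unit i j])"
    by (intro sum.cong) auto
  ultimately show ?thesis by (simp add: sum_pairs cross_moment_Nil[OF H])
qed

text \<open>At a symmetric \<open>P\<close> the integrands are \<open>P $ i $ j * P $ j $ k * P $ k $ i\<close>, and their sum is the
trace of \<open>P\<^sup>3\<close>.\<close>

lemma sum_cross_moment_sym_unit3:
  assumes H: "normalized_haar H"
  shows "(\<Sum>i\<in>UNIV. \<Sum>j\<in>UNIV. \<Sum>k\<in>UNIV.
    cross_moment H v [sym_unit i j, sym_unit j k, sym_unit k i]) = power_trace v 3"
proof -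
  let ?L = "\<lambda>(i, j, k). [sym_unit i j, sym_unit j k, sym_unit k i]"
  have "(\<Sum>p\<in>UNIV. 1 * cross_moment H v (?L p)) = power_trace v 3 * cross_moment H v []"
  proof (rule cross_moment_linear_relation[OF H])
    fix P assume P: "P \<in> conj_orbit v"
    have entry: "matrix_inner (sym_unit i j) P = P $ i $ j" for i j
      using conj_orbit_transpose[OF P] by (rule matrix_inner_sym_unit_symmetric)
    have "(\<Sum>p\<in>UNIV. 1 * (\<Prod>X\<leftarrow>?L p. matrix_inner X P)) =
        (\<Sum>(i, j, k)\<in>UNIV. P $ i $ j * P $ j $ k * P $ k $ i)"
      by (intro sum.cong) (auto simp: entry)
    also have "\<dots> = (\<Sum>i\<in>UNIV. \<Sum>k\<in>UNIV. \<Sum>j\<in>UNIV. P $ i $ j * P $ j $ k * P $ k $ i)"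
      unfolding sum_triples by (intro sum.cong refl sum.swap)
    also have "\<dots> = trace (P ** P ** P)"
      by (simp add: trace_def matrix_matrix_mult_def sum_distrib_right)
    finally show "(\<Sum>p\<in>UNIV. 1 * (\<Prod>X\<leftarrow>?L p. matrix_inner X P)) =
        power_trace v 3 * (\<Prod>X\<leftarrow>[]. matrix_inner X P)"
      by (simp add: conj_orbit_traces[OF P])
  qed simp
  moreover have "(\<Sum>p\<in>UNIV. 1 * cross_moment H v (?L p)) =
      (\<Sum>(i, j, k)\<in>UNIV. cross_moment H v [sym_unit i j, sym_unit j k, sym_unit k i])"
    by (intro sum.cong) auto
  ultimately show ?thesis by (simp add: sum_triples cross_moment_Nil[OF H])
qed

section \<open>Kernels invariant under permutations\<close>

lemma inj_on_extends_to_permutation: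
  fixes f :: "'a::finite \<Rightarrow> 'a"
  assumes "inj_on f A"
  shows "\<exists>p. bij p \<and> (\<forall>x\<in>A. p x = f x)"
proof -
  have "card (- A) = card (- f ` A)"
    using card_image[OF assms] by (simp add: Compl_eq_Diff_UNIV card_Diff_subset)
  then obtain g where g: "bij_betw g (- A) (- f ` A)"
    using finite_same_card_bij[of "- A" "- f ` A"] by auto
  define p where "p x = (if x \<in> A then f x else g x)" for x
  have "bij_betw p A (f ` A)"
    using assms by (simp add: p_def bij_betw_def inj_on_def cong: image_cong)
  moreover have "bij_betw p (- A) (- f ` A)"
    using g by (subst bij_betw_cong[where g = g]) (auto simp: p_def)
  ultimately have "bij_betw p (A \<union> - A) (f ` A \<union> - f ` A)"
    by (rule bij_betw_combine) auto
  then have "bij p" by simp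
  then show ?thesis by (auto simp: p_def)
qed

text \<open>Up to permutation of the index set and of its three arguments, a triple is determined by how many
of its entries coincide, so the kernel takes at most three values. With at least three indices all
three patterns occur. The values \<open>a\<close>, \<open>a + b\<close> and \<open>a + 3 * b + c\<close> belong to three distinct indices, to
exactly two equal ones and to three equal ones.\<close>

lemma permutation_invariant_kernel:
  fixes K :: "'n::finite \<Rightarrow> 'n \<Rightarrow> 'n \<Rightarrow> real"
  assumes card: "CARD('n) \<ge> 3"
    and sym12: "\<And>i j k. K i j k = K j i k" and sym23: "\<And>i j k. K i j k = K i k j"
    and inv: "\<And>p i j k. bij p \<Longrightarrow> K (p i) (p j) (p k) = K i j k"
  obtains a b c where "\<And>i j k. K i j k =
    a + b * (of_bool (i = j) + of_bool (j = k) + of_bool (i = k)) + c * of_bool (i = j \<and> j = k)"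
proof -
  obtain u v w :: 'n where uvw: "u \<noteq> v" "v \<noteq> w" "u \<noteq> w"
  proof -
    from card obtain T :: "'n set" where "card T = 3"
      using obtain_subset_with_card_n by blast
    then show ?thesis using that by (auto simp: card_3_iff)
  qed
  have K1: "K i i i = K u u u" for i
  proof -
    have "inj_on (\<lambda>_. i) {u}" by simp
    from inj_on_extends_to_permutation[OF this] obtain p where p: "bij p" "\<forall>x\<in>{u}. p x = i"
      by (elim exE conjE)
    then show ?thesis using inv[OF p(1), of u u u] by simp
  qed
  have K2: "K i i j = K u u v" if "i \<noteq> j" for i j
  proof -
    have "inj_on ((\<lambda>_. j)(u := i)) {u, v}" using that uvw by (auto simp: inj_on_def)
    from inj_on_extends_to_permutation[OF this] obtain p where p: "bij p" "\<forall>x\<in>{u, v}. p x = ((\<lambda>_. j)(u := i)) x"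
      by (elim exE conjE)
    have "p u = i" "p v = j" using p(2) uvw by auto
    then show ?thesis using inv[OF p(1), of u u v] by simp
  qed
  have K3: "K i j k = K u v w" if "i \<noteq> j" "j \<noteq> k" "i \<noteq> k" for i j k
  proof -
    have "inj_on ((\<lambda>_. k)(u := i, v := j)) {u, v, w}" using that uvw by (auto simp: inj_on_def)
    from inj_on_extends_to_permutation[OF this] obtain p where p: "bij p" "\<forall>x\<in>{u, v, w}. p x = ((\<lambda>_. k)(u := i, v := j)) x"
      by (elim exE conjE)
    have "p u = i" "p v = j" "p w = k" using p(2) uvw by auto
    then show ?thesis using inv[OF p(1), of u v w] by simp
  qed
  define a b c where "a = K u v w" and "b = K u u v - K u v w"
    and "c = K u u u - 3 * K u u v + 2 * K u v w"
  have "K i j k = a + b * (of_bool (i = j) + of_bool (j = k) + of_bool (i = k))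
      + c * of_bool (i = j \<and> j = k)" for i j k
  proof -
    consider "i = j" "j = k" | "i = j" "j \<noteq> k" | "i = k" "i \<noteq> j" | "j = k" "i \<noteq> j"
      | "i \<noteq> j" "j \<noteq> k" "i \<noteq> k" by blast
    then show ?thesis
    proof cases
      case 1 then show ?thesis using K1[of k] by (simp add: a_def b_def c_def)
    next
      case 2 then show ?thesis using K2[of j k] by (simp add: a_def b_def)
    next
      case 3
      then have "K i j k = K u u v" using K2[of i j] sym23[of i j i] by simp
      then show ?thesis using 3 by (simp add: a_def b_def)
    next
      case 4
      then have "K i j k = K u u v" using K2[of j i] sym23[of j j i] sym12[of i j j] by simp
      then show ?thesis using 4 by (simp add: a_def b_def)
    next
      case 5 then show ?thesis using K3[of i j k] by (simp add: a_def)
    qed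
  qed
  then show ?thesis by (rule that)
qed

lemma sum_of_bool_eq: "(\<Sum>j\<in>UNIV. of_bool (i = j) * g j) = g i"
  for g :: "'n::finite \<Rightarrow> real"
proof -
  have "of_bool (i = j) * g j = (if i = j then g j else 0)" for j by simp
  then show ?thesis by simp
qed

text \<open>The parametrization by coincidences is chosen so that a cubic form with such a kernel is a
combination of products of power sums. Power sums of eigenvalues are traces of matrix powers,
which makes the formula independent of the diagonalization.\<close>

lemma sum_coincidence_kernel:
  fixes x :: "'n::finite \<Rightarrow> real"
  shows "(\<Sum>i\<in>UNIV. \<Sum>j\<in>UNIV. \<Sum>k\<in>UNIV. x i * x j * x k *
      (a + b * (of_bool (i = j) + of_bool (j = k) + of_bool (i = k)) + c * of_bool (i = j \<and> j = k))) =
    a * (\<Sum>i\<in>UNIV. x i)^3 + 3 * b * (\<Sum>i\<in>UNIV. x i) * (\<Sum>i\<in>UNIV. (x i)^2) + c * (\<Sum>i\<in>UNIV. (x i)^3)"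
proof -
  let ?t = "\<Sum>i\<in>UNIV. x i" and ?t2 = "\<Sum>i\<in>UNIV. (x i)^2"
  have inner: "(\<Sum>k\<in>UNIV. x i * x j * x k *
      (a + b * (of_bool (i = j) + of_bool (j = k) + of_bool (i = k)) + c * of_bool (i = j \<and> j = k))) =
    a * ?t * x i * x j + b * x i * (x j)^2 + b * (x i)^2 * x j
     + of_bool (i = j) * (b * ?t * x i * x j + c * x i * (x j)^2)" for i j
  proof -
    have "(\<Sum>k\<in>UNIV. x i * x j * x k *
      (a + b * (of_bool (i = j) + of_bool (j = k) + of_bool (i = k)) + c * of_bool (i = j \<and> j = k))) =
      (\<Sum>k\<in>UNIV. x i * x j * (a + b * of_bool (i = j)) * x k
         + of_bool (j = k) * ((b + c * of_bool (i = j)) * x i * x j * x k)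
         + of_bool (i = k) * (b * x i * x j * x k))"
      by (intro sum.cong refl) (simp only: of_bool_conj, algebra)
    also have "\<dots> = x i * x j * (a + b * of_bool (i = j)) * ?t
       + (b + c * of_bool (i = j)) * x i * x j * x j + b * x i * x j * x i"
      by (simp only: sum.distrib sum_of_bool_eq sum_distrib_left)
    finally show ?thesis by algebra
  qed
  have mid: "(\<Sum>j\<in>UNIV. a * ?t * x i * x j + b * x i * (x j)^2 + b * (x i)^2 * x j
     + of_bool (i = j) * (b * ?t * x i * x j + c * x i * (x j)^2)) =
     a * ?t^2 * x i + b * ?t2 * x i + 2 * b * ?t * (x i)^2 + c * (x i)^3" for i
  proof -
    have "(\<Sum>j\<in>UNIV. a * ?t * x i * x j + b * x i * (x j)^2 + b * (x i)^2 * x j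
     + of_bool (i = j) * (b * ?t * x i * x j + c * x i * (x j)^2)) =
     a * ?t * x i * ?t + b * x i * ?t2 + b * (x i)^2 * ?t + (b * ?t * x i * x i + c * x i * (x i)^2)"
      by (simp only: sum.distrib sum_of_bool_eq sum_distrib_left)
    then show ?thesis by algebra
  qed
  have "(\<Sum>i\<in>UNIV. a * ?t^2 * x i + b * ?t2 * x i + 2 * b * ?t * (x i)^2 + c * (x i)^3) =
    a * ?t^2 * ?t + b * ?t2 * ?t + 2 * b * ?t * ?t2 + c * (\<Sum>i\<in>UNIV. (x i)^3)"
    by (simp only: sum.distrib sum_distrib_left)
  also have "\<dots> = a * ?t^3 + 3 * b * ?t * ?t2 + c * (\<Sum>i\<in>UNIV. (x i)^3)"
    by algebra
  finally show ?thesis unfolding inner mid .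
qed

section \<open>The third moment as an invariant trilinear form\<close>

lemma matrix_inner_diag_matrix: "matrix_inner (diag_matrix x) P = (\<Sum>i\<in>UNIV. x $ i * P $ i $ i)"
proof -
  have "(if i = j then x $ i else 0) * P $ i $ j = (if i = j then x $ i * P $ i $ j else 0)" for i j
    by simp
  then show ?thesis by (simp add: matrix_inner_eq_sum diag_matrix_def)
qed

lemma matrix_inner_diag_axis: "matrix_inner (diag_matrix (axis i 1)) P = P $ i $ i"
proof -
  have "axis i 1 $ j * P $ j $ j = (if j = i then P $ j $ j else 0)" for j
    by (simp add: axis_def)
  then show ?thesis by (simp add: matrix_inner_diag_matrix)
qed

lemma cross_moment_diag_cube_expand:
  assumes H: "normalized_haar H"
  shows "cross_moment H v [diag_matrix x, diag_matrix x, diag_matrix x] =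
    (\<Sum>i\<in>UNIV. \<Sum>j\<in>UNIV. \<Sum>k\<in>UNIV. x $ i * x $ j * x $ k *
      cross_moment H v [diag_matrix (axis i 1), diag_matrix (axis j 1), diag_matrix (axis k 1)])"
proof -
  let ?D = "\<lambda>i. diag_matrix (axis i 1)"
  let ?L = "\<lambda>(i, j, k). [?D i, ?D j, ?D k]"
  let ?w = "\<lambda>(i, j, k). x $ i * x $ j * x $ k"
  have "(\<Sum>p\<in>UNIV. ?w p * cross_moment H v (?L p)) =
      1 * cross_moment H v [diag_matrix x, diag_matrix x, diag_matrix x]"
  proof (rule cross_moment_linear_relation[OF H])
    fix P
    have "(\<Sum>p\<in>UNIV. ?w p * (\<Prod>X\<leftarrow>?L p. matrix_inner X P)) =
        (\<Sum>(i, j, k)\<in>UNIV. (x $ i * P $ i $ i) * ((x $ j * P $ j $ j) * (x $ k * P $ k $ k)))"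
      by (intro sum.cong) (auto simp: matrix_inner_diag_axis)
    also have "\<dots> = (\<Sum>i\<in>UNIV. x $ i * P $ i $ i) *
        ((\<Sum>i\<in>UNIV. x $ i * P $ i $ i) * (\<Sum>i\<in>UNIV. x $ i * P $ i $ i))"
      by (simp only: sum_triples sum_product) (simp only: sum_distrib_left)
    finally show "(\<Sum>p\<in>UNIV. ?w p * (\<Prod>X\<leftarrow>?L p. matrix_inner X P)) =
        1 * (\<Prod>X\<leftarrow>[diag_matrix x, diag_matrix x, diag_matrix x]. matrix_inner X P)"
      by (simp add: matrix_inner_diag_matrix)
  qed simp
  moreover have "(\<Sum>p\<in>UNIV. ?w p * cross_moment H v (?L p)) =
      (\<Sum>(i, j, k)\<in>UNIV. x $ i * x $ j * x $ k * cross_moment H v [?D i, ?D j, ?D k])"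
    by (intro sum.cong) auto
  ultimately show ?thesis by (simp add: sum_triples)
qed

text \<open>Conjugation by a permutation matrix permutes the diagonal matrix units.\<close>

lemma cross_moment_diag_permute:
  fixes p :: "'n::finite \<Rightarrow> 'n"
  assumes H: "normalized_haar H" and p: "bij p"
  shows "cross_moment H v (map (\<lambda>i. diag_matrix (axis (p i) 1)) is) =
    cross_moment H v (map (\<lambda>i. diag_matrix (axis i 1)) is)"
proof -
  define U :: "real^'n^'n" where "U = (\<chi> i. axis (p i) 1)"
  have inj: "p i = p j \<longleftrightarrow> i = j" for i j
    using p by (meson bij_is_inj injD)
  have "orthogonal_matrix U"
    by (simp add: orthogonal_iff_rows U_def inner_axis_axis inj)
  moreover have "U ** diag_matrix (axis (p i) 1) ** transpose U = diag_matrix (axis i 1)" for i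
  proof -
    have "(U ** diag_matrix (axis (p i) 1) ** transpose U) $ r $ s = diag_matrix (axis i 1) $ r $ s" for r s
    proof -
      have "(U ** diag_matrix (axis (p i) 1) ** transpose U) $ r $ s = diag_matrix (axis (p i) 1) $ p r $ p s"
        by (simp add: conj_nth U_def inner_axis_matrix_axis)
      then show ?thesis by (simp add: diag_matrix_def axis_def inj)
    qed
    then show ?thesis by (simp add: vec_eq_iff)
  qed
  ultimately show ?thesis
    using cross_moment_conj[OF H, of U v "map (\<lambda>i. diag_matrix (axis (p i) 1)) is"]
    by (simp add: o_def)
qed

text \<open>Polarization: the value at \<open>(x, y, z)\<close> of a symmetric form that is additive in each argument is a
combination of its values on the diagonal.\<close>

lemma symmetric_triadditive_eqI:
  fixes B C :: "'a::ab_semigroup_add \<Rightarrow> 'a \<Rightarrow> 'a \<Rightarrow> real"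
  assumes closed: "\<And>x y. x \<in> S \<Longrightarrow> y \<in> S \<Longrightarrow> x + y \<in> S"
    and B: "\<And>x y z w. x \<in> S \<Longrightarrow> y \<in> S \<Longrightarrow> z \<in> S \<Longrightarrow> w \<in> S \<Longrightarrow> B (x + w) y z = B x y z + B w y z"
      "\<And>x y z. x \<in> S \<Longrightarrow> y \<in> S \<Longrightarrow> z \<in> S \<Longrightarrow> B x y z = B y x z"
      "\<And>x y z. x \<in> S \<Longrightarrow> y \<in> S \<Longrightarrow> z \<in> S \<Longrightarrow> B x y z = B x z y"
    and C: "\<And>x y z w. x \<in> S \<Longrightarrow> y \<in> S \<Longrightarrow> z \<in> S \<Longrightarrow> w \<in> S \<Longrightarrow> C (x + w) y z = C x y z + C w y z"
      "\<And>x y z. x \<in> S \<Longrightarrow> y \<in> S \<Longrightarrow> z \<in> S \<Longrightarrow> C x y z = C y x z"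
      "\<And>x y z. x \<in> S \<Longrightarrow> y \<in> S \<Longrightarrow> z \<in> S \<Longrightarrow> C x y z = C x z y"
    and diag: "\<And>x. x \<in> S \<Longrightarrow> B x x x = C x x x"
    and S: "x \<in> S" "y \<in> S" "z \<in> S"
  shows "B x y z = C x y z"
proof -
  let ?cubes = "\<lambda>D :: 'a \<Rightarrow> 'a \<Rightarrow> 'a \<Rightarrow> real. D (x + (y + z)) (x + (y + z)) (x + (y + z))
      - D (x + y) (x + y) (x + y) - D (x + z) (x + z) (x + z) - D (y + z) (y + z) (y + z)
      + D x x x + D y y y + D z z z"
  have pol: "6 * D x y z = ?cubes D"
    if add: "\<And>x y z w. x \<in> S \<Longrightarrow> y \<in> S \<Longrightarrow> z \<in> S \<Longrightarrow> w \<in> S \<Longrightarrow> D (x + w) y z = D x y z + D w y z"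
      and sym12: "\<And>x y z. x \<in> S \<Longrightarrow> y \<in> S \<Longrightarrow> z \<in> S \<Longrightarrow> D x y z = D y x z"
      and sym23: "\<And>x y z. x \<in> S \<Longrightarrow> y \<in> S \<Longrightarrow> z \<in> S \<Longrightarrow> D x y z = D x z y"
    for D :: "'a \<Rightarrow> 'a \<Rightarrow> 'a \<Rightarrow> real"
  proof -
    have add2: "D u (v + w) t = D u v t + D u w t" if "u \<in> S" "v \<in> S" "w \<in> S" "t \<in> S" for u v w t
      using that by (simp add: sym12[of u] add closed)
    have add3: "D u t (v + w) = D u t v + D u t w" if "u \<in> S" "v \<in> S" "w \<in> S" "t \<in> S" for u v w t
      using that by (simp add: sym23[of u t] add2 closed)
    have s: "D y x z = D x y z" "D x z y = D x y z" "D y z x = D x y z" "D z x y = D x y z" "D z y x = D x y z"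
      "D y x x = D x x y" "D x y x = D x x y" "D z x x = D x x z" "D x z x = D x x z"
      "D z y y = D y y z" "D y z y = D y y z" "D x y y = D y y x" "D y x y = D y y x"
      "D x z z = D z z x" "D z x z = D z z x" "D y z z = D z z y" "D z y z = D z z y"
      using S by (metis sym12 sym23)+
    show ?thesis using S by (simp add: add add2 add3 closed s)
  qed
  have "6 * B x y z = ?cubes B" by (rule pol) (fact B)+
  also have "\<dots> = ?cubes C" using S by (simp add: diag closed)
  also have "\<dots> = 6 * C x y z" by (rule pol[symmetric]) (fact C)+
  finally show ?thesis by simp
qed

text \<open>The general symmetric trilinear form on symmetric matrices that is invariant under orthogonal
conjugation.\<close>

definition invariant_trilinear :: "real \<Rightarrow> real \<Rightarrow> real \<Rightarrow> real^'n^'n \<Rightarrow> real^'n^'n \<Rightarrow> real^'n^'n \<Rightarrow> real" where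
  "invariant_trilinear a b c X Y Z = a * trace X * trace Y * trace Z
    + b * (trace X * trace (Y ** Z) + trace Y * trace (X ** Z) + trace Z * trace (X ** Y))
    + c * trace (X ** Y ** Z)"

text \<open>Transposing a product of symmetric matrices reverses it. Together with cyclic invariance of the
trace this makes the trace of a triple product fully symmetric.\<close>

lemma trace_mult_sym3:
  fixes X Y Z :: "real^'n^'n"
  assumes "transpose X = X" "transpose Y = Y" "transpose Z = Z"
  shows "trace (X ** Y ** Z) = trace (Y ** X ** Z)" "trace (X ** Y ** Z) = trace (X ** Z ** Y)"
proof -
  have rev: "trace (A ** B ** C) = trace (B ** A ** C)"
    if "transpose A = A" "transpose B = B" "transpose C = C" for A B C :: "real^'n^'n"
  proof -
    have "trace (A ** B ** C) = trace (transpose (A ** B ** C))" by (rule trace_transpose[symmetric])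
    also have "\<dots> = trace (C ** (B ** A))" using that by (simp add: matrix_transpose_mul)
    also have "\<dots> = trace (B ** A ** C)" by (rule trace_mul_sym)
    finally show ?thesis .
  qed
  show "trace (X ** Y ** Z) = trace (Y ** X ** Z)" using assms by (rule rev)
  have "trace (X ** Y ** Z) = trace (Y ** (X ** Z))" using rev[OF assms] by (simp only: matrix_mul_assoc)
  also have "\<dots> = trace (X ** Z ** Y)" by (rule trace_mul_sym)
  finally show "trace (X ** Y ** Z) = trace (X ** Z ** Y)" .
qed

lemma invariant_trilinear_add:
  fixes X W Y Z :: "real^'n^'n"
  shows "invariant_trilinear a b c (X + W) Y Z = invariant_trilinear a b c X Y Z + invariant_trilinear a b c W Y Z"
proof -
  have "(A + B) ** M = A ** M + B ** M" for A B M :: "real^'n^'n"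
    by (simp add: vec_eq_iff matrix_matrix_mult_def distrib_right sum.distrib)
  then show ?thesis by (simp add: invariant_trilinear_def trace_add algebra_simps)
qed

lemma invariant_trilinear_swap:
  assumes "transpose X = X" "transpose Y = Y" "transpose Z = Z"
  shows "invariant_trilinear a b c X Y Z = invariant_trilinear a b c Y X Z"
    "invariant_trilinear a b c X Y Z = invariant_trilinear a b c X Z Y"
proof -
  show "invariant_trilinear a b c X Y Z = invariant_trilinear a b c Y X Z"
    unfolding invariant_trilinear_def trace_mult_sym3(1)[OF assms] trace_mul_sym[of Y X]
    by algebra
  show "invariant_trilinear a b c X Y Z = invariant_trilinear a b c X Z Y"
    unfolding invariant_trilinear_def trace_mult_sym3(2)[OF assms] trace_mul_sym[of Z Y]
    by algebra
qed

lemma invariant_trilinear_conj: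
  assumes U: "orthogonal_matrix U"
  shows "invariant_trilinear a b c (U ** X ** transpose U) (U ** Y ** transpose U) (U ** Z ** transpose U) =
    invariant_trilinear a b c X Y Z"
  by (simp only: invariant_trilinear_def conj_mult[OF U] trace_conj[OF U])

lemma invariant_trilinear_diag:
  "invariant_trilinear a b c (diag_matrix x) (diag_matrix x) (diag_matrix x) =
    a * (\<Sum>i\<in>UNIV. x $ i)^3 + 3 * b * (\<Sum>i\<in>UNIV. x $ i) * (\<Sum>i\<in>UNIV. (x $ i)^2)
      + c * (\<Sum>i\<in>UNIV. (x $ i)^3)"
  by (simp add: invariant_trilinear_def diag_matrix_mult trace_diag_matrix power2_eq_square power3_eq_cube)

text \<open>By polarization it suffices to treat equal arguments, and by diagonalization and conjugation
invariance the common argument may be taken diagonal. There the moment is a cubic form in the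
diagonal entries whose kernel is invariant under permutations.\<close>

lemma third_moment_invariant_trilinear:
  fixes H :: "(real^'n^'n) measure"
  assumes H: "normalized_haar H" and card: "CARD('n) \<ge> 3"
  obtains a b c where "\<And>X Y Z. X \<in> symmetric_matrices \<Longrightarrow> Y \<in> symmetric_matrices \<Longrightarrow> Z \<in> symmetric_matrices \<Longrightarrow>
    cross_moment H v [X, Y, Z] = invariant_trilinear a b c X Y Z"
proof -
  let ?D = "\<lambda>i::'n. diag_matrix (axis i 1)"
  obtain a b c where abc: "\<And>i j k. cross_moment H v [?D i, ?D j, ?D k] =
      a + b * (of_bool (i = j) + of_bool (j = k) + of_bool (i = k)) + c * of_bool (i = j \<and> j = k)"
  proof (rule permutation_invariant_kernel[OF card, of "\<lambda>i j k. cross_moment H v [?D i, ?D j, ?D k]"])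
    fix i j k
    show "cross_moment H v [?D i, ?D j, ?D k] = cross_moment H v [?D j, ?D i, ?D k]"
      "cross_moment H v [?D i, ?D j, ?D k] = cross_moment H v [?D i, ?D k, ?D j]"
      by (intro cross_moment_perm[OF H], simp)+
    fix p :: "'n \<Rightarrow> 'n" assume "bij p"
    then show "cross_moment H v [?D (p i), ?D (p j), ?D (p k)] = cross_moment H v [?D i, ?D j, ?D k]"
      using cross_moment_diag_permute[OF H, of p v "[i, j, k]"] by simp
  qed blast
  have cube: "cross_moment H v [X, X, X] = invariant_trilinear a b c X X X" if X: "X \<in> symmetric_matrices" for X
  proof -
    from X obtain U x where U: "orthogonal_matrix U" and D: "U ** X ** transpose U = diag_matrix x"
      unfolding symmetric_matrices_def by (blast elim: orthogonal_diagonalization)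
    have "cross_moment H v [X, X, X] = cross_moment H v [diag_matrix x, diag_matrix x, diag_matrix x]"
      using cross_moment_conj[OF H U, of v "[X, X, X]"] by (simp add: D)
    also have "\<dots> = invariant_trilinear a b c (diag_matrix x) (diag_matrix x) (diag_matrix x)"
      unfolding cross_moment_diag_cube_expand[OF H] abc invariant_trilinear_diag
      by (rule sum_coincidence_kernel)
    also have "\<dots> = invariant_trilinear a b c X X X"
      using invariant_trilinear_conj[OF U, of a b c X X X] by (simp add: D)
    finally show ?thesis .
  qed
  have "cross_moment H v [X, Y, Z] = invariant_trilinear a b c X Y Z"
    if "X \<in> symmetric_matrices" "Y \<in> symmetric_matrices" "Z \<in> symmetric_matrices" for X Y Z
    using that
  proof (rule symmetric_triadditive_eqI[rotated 8, where B = "\<lambda>X Y Z. cross_moment H v [X, Y, Z]"])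
    fix X Y Z W :: "real^'n^'n"
    assume "X \<in> symmetric_matrices" "Y \<in> symmetric_matrices" "Z \<in> symmetric_matrices"
    then have "transpose X = X" "transpose Y = Y" "transpose Z = Z"
      by (simp_all add: symmetric_matrices_def)
    then show "invariant_trilinear a b c X Y Z = invariant_trilinear a b c Y X Z"
      "invariant_trilinear a b c X Y Z = invariant_trilinear a b c X Z Y"
      by (fact invariant_trilinear_swap)+
    show "cross_moment H v [X, Y, Z] = cross_moment H v [Y, X, Z]"
      "cross_moment H v [X, Y, Z] = cross_moment H v [X, Z, Y]"
      by (intro cross_moment_perm[OF H], simp)+
    show "cross_moment H v [X + W, Y, Z] = cross_moment H v [X, Y, Z] + cross_moment H v [W, Y, Z]"
      by (rule cross_moment_add[OF H])
    show "invariant_trilinear a b c (X + W) Y Z = invariant_trilinear a b c X Y Z + invariant_trilinear a b c W Y Z"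
      by (rule invariant_trilinear_add)
    show "cross_moment H v [X, X, X] = invariant_trilinear a b c X X X"
      using cube \<open>X \<in> symmetric_matrices\<close> .
  next
    fix X Y :: "real^'n^'n"
    assume "X \<in> symmetric_matrices" "Y \<in> symmetric_matrices"
    then show "X + Y \<in> symmetric_matrices"
      by (simp add: symmetric_matrices_def transpose_def vec_eq_iff)
  qed
  then show ?thesis by (rule that)
qed

section \<open>The coefficients\<close>

lemma sym_unit_in_symmetric_matrices: "sym_unit i j \<in> symmetric_matrices"
  by (simp add: symmetric_matrices_def transpose_sym_unit)

lemma mat_1_in_symmetric_matrices: "mat 1 \<in> symmetric_matrices"
  by (simp add: symmetric_matrices_def)

lemma invariant_trilinear_mat_1:
  "invariant_trilinear a b c X Y (mat 1 :: real^'n^'n) =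
    (a * real CARD('n) + 2 * b) * trace X * trace Y + (b * real CARD('n) + c) * trace (X ** Y)"
  by (simp add: invariant_trilinear_def trace_I algebra_simps)

lemma sum_invariant_trilinear_sym_unit2:
  fixes a b c :: real
  defines "d \<equiv> real CARD('n)"
  shows "(\<Sum>i\<in>UNIV. \<Sum>j\<in>UNIV. invariant_trilinear a b c (sym_unit i j) (sym_unit i j) (mat 1 :: real^'n^'n)) =
    (a * d + 2 * b) * d + (b * d + c) * (d^2 + d) / 2"
proof -
  have "invariant_trilinear a b c (sym_unit i j) (sym_unit i j) (mat 1 :: real^'n^'n) =
      (b * d + c) / 2 + of_bool (i = j) * (a * d + 2 * b + (b * d + c) / 2)" for i j
    unfolding invariant_trilinear_mat_1 trace_sym_unit trace_sym_unit_mult d_def[symmetric]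
    by (cases "i = j") simp_all
  then have "(\<Sum>i\<in>UNIV. \<Sum>j\<in>UNIV. invariant_trilinear a b c (sym_unit i j) (sym_unit i j) (mat 1 :: real^'n^'n)) =
      d * (d * ((b * d + c) / 2) + (a * d + 2 * b + (b * d + c) / 2))"
    by (simp only: sum.distrib sum_of_bool_eq sum_constant d_def)
       (simp add: algebra_simps)
  then show ?thesis by (simp add: algebra_simps power2_eq_square add_divide_distrib)
qed

lemma sum_invariant_trilinear_sym_unit3:
  fixes a b c :: real
  defines "d \<equiv> real CARD('n)"
  shows "(\<Sum>i\<in>UNIV. \<Sum>j\<in>UNIV. \<Sum>k\<in>UNIV. invariant_trilinear a b c (sym_unit i j) (sym_unit j k) (sym_unit k i :: real^'n^'n)) =
    a * d + 3 * b * (d^2 + d) / 2 + c * (d^3 + 3 * d^2 + 4 * d) / 8"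
proof -
  \<comment> \<open>The factor \<open>1 * 1 * 1\<close> stands for the weights in \<open>sum_coincidence_kernel\<close>.\<close>
  have "invariant_trilinear a b c (sym_unit i j) (sym_unit j k) (sym_unit k i :: real^'n^'n) =
      1 * 1 * 1 * (c / 8 + (b / 2 + c / 8) * (of_bool (i = j) + of_bool (j = k) + of_bool (i = k))
        + (a + 3 * b / 2 + c / 2) * of_bool (i = j \<and> j = k))" for i j k
  proof -
    consider "i = j" "j = k" | "i = j" "j \<noteq> k" | "i = k" "i \<noteq> j" | "j = k" "i \<noteq> j"
      | "i \<noteq> j" "j \<noteq> k" "i \<noteq> k" by blast
    then show ?thesis
      unfolding invariant_trilinear_def trace_sym_unit trace_sym_unit_mult trace_sym_unit_cycle
      by cases simp_all
  qed
  then show ?thesis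
    unfolding d_def
    by (simp only: sum_coincidence_kernel) (simp add: field_simps power2_eq_square power3_eq_cube)
qed

text \<open>The expectations of \<open>(trace P)\<^sup>3\<close>, of \<open>trace P * trace (P ** P)\<close> and of \<open>trace (P ** P ** P)\<close> are known,
because the three traces are constant on the orbit. Expressing each of them through third moments
gives three linear equations for the three coefficients.\<close>

lemma third_moment_equations:
  fixes H :: "(real^'n^'n) measure" and v :: "real^'n"
  assumes H: "normalized_haar H"
    and F: "\<And>X Y Z. X \<in> symmetric_matrices \<Longrightarrow> Y \<in> symmetric_matrices \<Longrightarrow> Z \<in> symmetric_matrices \<Longrightarrow>
      cross_moment H v [X, Y, Z] = invariant_trilinear a b c X Y Z"
  defines "d \<equiv> real CARD('n)"
  shows "power_trace v 1 ^ 3 = a * d^3 + 3 * b * d^2 + c * d"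
    "power_trace v 1 * power_trace v 2 = (a * d + 2 * b) * d + (b * d + c) * (d^2 + d) / 2"
    "power_trace v 3 = a * d + 3 * b * (d^2 + d) / 2 + c * (d^3 + 3 * d^2 + 4 * d) / 8"
proof -
  let ?I = "mat 1 :: real^'n^'n"
  note sym = sym_unit_in_symmetric_matrices mat_1_in_symmetric_matrices
  have "power_trace v 1 ^ 3 = cross_moment H v [?I, ?I, ?I]"
    by (simp add: cross_moment_mat_1_Cons[OF H] cross_moment_Nil[OF H] power3_eq_cube)
  then show "power_trace v 1 ^ 3 = a * d^3 + 3 * b * d^2 + c * d"
    unfolding F[OF sym(2) sym(2) sym(2)] invariant_trilinear_mat_1
    by (simp add: trace_I d_def algebra_simps power2_eq_square power3_eq_cube)
  have "cross_moment H v [sym_unit i j, sym_unit i j, ?I] =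
      power_trace v 1 * cross_moment H v [sym_unit i j, sym_unit i j]" for i j
    using cross_moment_perm[OF H, of "[sym_unit i j, sym_unit i j, ?I]" "[?I, sym_unit i j, sym_unit i j]" v]
    by (simp add: cross_moment_mat_1_Cons[OF H] add_mset_commute)
  then have "power_trace v 1 * power_trace v 2 =
      (\<Sum>i\<in>UNIV. \<Sum>j\<in>UNIV. cross_moment H v [sym_unit i j, sym_unit i j, ?I])"
    by (simp add: sum_distrib_left[symmetric] sum_cross_moment_sym_unit2[OF H])
  then show "power_trace v 1 * power_trace v 2 = (a * d + 2 * b) * d + (b * d + c) * (d^2 + d) / 2"
    unfolding F[OF sym(1) sym(1) sym(2)] sum_invariant_trilinear_sym_unit2 d_def .
  show "power_trace v 3 = a * d + 3 * b * (d^2 + d) / 2 + c * (d^3 + 3 * d^2 + 4 * d) / 8"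
    using sum_cross_moment_sym_unit3[OF H, of v]
    unfolding F[OF sym(1) sym(1) sym(1)] sum_invariant_trilinear_sym_unit3 d_def by simp
qed

text \<open>The three combinations are the rows of the inverse of the system, with \<open>q\<close> as common denominator.
The second unknown is taken to be \<open>3 * b\<close>, the total weight of the three mixed terms of the form.\<close>

lemma moment_equations_solution:
  fixes d a b c s1 s2 s3 :: real
  assumes e: "s1^3 = a * d^3 + 3 * b * d^2 + c * d"
    "s1 * s2 = (a * d + 2 * b) * d + (b * d + c) * (d^2 + d) / 2"
    "s3 = a * d + 3 * b * (d^2 + d) / 2 + c * (d^3 + 3 * d^2 + 4 * d) / 8"
  defines "q \<equiv> (d - 2) * (d - 1) * d * (d + 2) * (d + 4)"
  shows "(d^2 + 3 * d - 2) * s1^3 - 6 * (d + 2) * (s1 * s2) + 16 * s3 = q * a"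
    "- 6 * (d + 2) * s1^3 + 6 * (d^2 + 2 * d + 4) * (s1 * s2) - 24 * d * s3 = q * (3 * b)"
    "16 * s1^3 - 24 * d * (s1 * s2) + 8 * d^2 * s3 = q * c"
  unfolding e q_def by (simp_all add: field_simps power2_eq_square power3_eq_cube)

text \<open>Passing from degree three to lower degrees divides by the trace of the orbit points; here it is
seen to be nonzero.\<close>

lemma admissible_spectrum_power_trace_pos:
  fixes v :: "real^'n::{finite,linorder}"
  assumes "admissible_spectrum v k"
  shows "power_trace v 1 > 0"
proof -
  have nonneg: "v $ i \<ge> 0" for i
    using assms unfolding admissible_spectrum_def
    by (cases "position i \<le> k") (auto intro: less_imp_le)
  define m where "m = (Min UNIV :: 'n)"
  have "{j. j \<le> m} = {m}" unfolding m_def by (auto intro: antisym)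
  then have "position m = 1" by (simp add: position_def)
  then have "v $ m > 0" using assms by (simp add: admissible_spectrum_def)
  then have "(\<Sum>i\<in>UNIV. v $ i) > 0"
    using nonneg by (intro sum_pos2[of UNIV m]) auto
  then show ?thesis by (simp add: power_trace_def trace_diag_matrix)
qed

theorem theorem7p3:
  fixes lam :: "real^'n::{finite,linorder}"
    and k :: nat
    and H :: "(real^'n::{finite,linorder}^'n::{finite,linorder}) measure"
    and X1 X2 X3 :: "real^'n::{finite,linorder}^'n::{finite,linorder}"
  assumes "CARD('n) \<ge> 3"
    and "admissible_spectrum lam k"
    and "normalized_haar H"
    and "X1 \<in> symmetric_matrices" and "X2 \<in> symmetric_matrices" and "X3 \<in> symmetric_matrices"
  shows "let d = real CARD('n);
             s1 = power_trace lam 1; s2 = power_trace lam 2; s3 = power_trace lam 3;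
             q1 = d;
             a1 = s1;
             q2 = (d - 1) * d * (d + 2);
             a11 = (d + 1) * s1^2 - 2 * s2;
             a2 = - 2 * s1^2 + 2 * d * s2;
             q3 = (d - 2) * (d - 1) * d * (d + 2) * (d + 4);
             a111 = (d^2 + 3 * d - 2) * s1^3 - 6 * (d + 2) * s1 * s2 + 16 * s3;
             a21 = - 6 * (d + 2) * s1^3 + 6 * (d^2 + 2 * d + 4) * s1 * s2 - 24 * d * s3;
             a3 = 16 * s1^3 - 24 * d * s1 * s2 + 8 * d^2 * s3
         in cross_moment H lam [X1] = 1 / q1 * (a1 * trace X1) \<and>
            cross_moment H lam [X1, X2] =
              1 / q2 * (a11 * trace X1 * trace X2 + a2 * trace (X1 ** X2)) \<and>
            cross_moment H lam [X1, X2, X3] =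
              1 / q3 * (a111 * trace X1 * trace X2 * trace X3
                + a21 / 3 * (trace X1 * trace (X2 ** X3) + trace X2 * trace (X1 ** X3)
                             + trace X3 * trace (X1 ** X2))
                + a3 * trace (X1 ** X2 ** X3))"
proof -
  note H = assms(3) and sym = assms(4-6)
  let ?I = "mat 1 :: real^'n::{finite,linorder}^'n::{finite,linorder}"
  define d s1 s2 s3 where "d = real CARD('n)" and "s1 = power_trace lam 1"
    and "s2 = power_trace lam 2" and "s3 = power_trace lam 3"
  note defs = d_def[symmetric] s1_def[symmetric] s2_def[symmetric] s3_def[symmetric]
  have "d \<ge> 3" using assms(1) by (simp add: d_def)
  have "s1 > 0" using admissible_spectrum_power_trace_pos[OF assms(2)] by (simp add: s1_def)
  define q2 q3 where "q2 = (d - 1) * d * (d + 2)" and "q3 = (d - 2) * (d - 1) * d * (d + 2) * (d + 4)"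
  have q: "q2 \<noteq> 0" "q3 \<noteq> 0" "q3 = q2 * ((d - 2) * (d + 4))"
    using \<open>d \<ge> 3\<close> by (auto simp: q2_def q3_def)
  obtain a b c where F: "\<And>X Y Z. X \<in> symmetric_matrices \<Longrightarrow> Y \<in> symmetric_matrices \<Longrightarrow> Z \<in> symmetric_matrices \<Longrightarrow>
      cross_moment H lam [X, Y, Z] = invariant_trilinear a b c X Y Z"
    using third_moment_invariant_trilinear[OF H assms(1)] by blast
  note eqs = third_moment_equations[OF H F, unfolded defs]
  have sol: "q3 * a = (d^2 + 3 * d - 2) * s1^3 - 6 * (d + 2) * s1 * s2 + 16 * s3"
    "q3 * (3 * b) = - 6 * (d + 2) * s1^3 + 6 * (d^2 + 2 * d + 4) * s1 * s2 - 24 * d * s3"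
    "q3 * c = 16 * s1^3 - 24 * d * s1 * s2 + 8 * d^2 * s3"
    using moment_equations_solution[OF eqs] unfolding q3_def[symmetric] by (simp_all only: mult.assoc)
  have third: "cross_moment H lam [X1, X2, X3] = 1 / q3 *
     (((d^2 + 3 * d - 2) * s1^3 - 6 * (d + 2) * s1 * s2 + 16 * s3) * trace X1 * trace X2 * trace X3
      + (- 6 * (d + 2) * s1^3 + 6 * (d^2 + 2 * d + 4) * s1 * s2 - 24 * d * s3) / 3
        * (trace X1 * trace (X2 ** X3) + trace X2 * trace (X1 ** X3) + trace X3 * trace (X1 ** X2))
      + (16 * s1^3 - 24 * d * s1 * s2 + 8 * d^2 * s3) * trace (X1 ** X2 ** X3))"
    unfolding F[OF sym] invariant_trilinear_def
    unfolding sol[symmetric] using q(2) by (simp add: field_simps)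
  \<comment> \<open>The factor \<open>s1\<close> comes from the identity matrix as third argument.\<close>
  have degree2: "s1 * cross_moment H lam [X, Y] = (a * d + 2 * b) * trace X * trace Y + (b * d + c) * trace (X ** Y)"
    if "X \<in> symmetric_matrices" "Y \<in> symmetric_matrices" for X Y
  proof -
    have "s1 * cross_moment H lam [X, Y] = cross_moment H lam [?I, X, Y]"
      by (simp add: cross_moment_mat_1_Cons[OF H] s1_def)
    also have "\<dots> = cross_moment H lam [X, Y, ?I]"
      by (rule cross_moment_perm[OF H]) simp
    finally show ?thesis
      unfolding F[OF that mat_1_in_symmetric_matrices] invariant_trilinear_mat_1 d_def .
  qed
  \<comment> \<open>For the coefficients of the second moment both \<open>s1\<close> and \<open>q3 / q2 = (d - 2) * (d + 4)\<close> split off,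
    and all terms with \<open>s3\<close> cancel.\<close>
  have ad_b: "q3 * (a * d + 2 * b) = s1 * ((d - 2) * (d + 4) * ((d + 1) * s1^2 - 2 * s2))"
  proof -
    have "q3 * (a * d + 2 * b) = d * (q3 * a) + 2 / 3 * (q3 * (3 * b))"
      by (simp add: algebra_simps)
    also have "\<dots> = s1 * ((d - 2) * (d + 4) * ((d + 1) * s1^2 - 2 * s2))"
      unfolding sol by (simp add: field_simps power2_eq_square power3_eq_cube)
    finally show ?thesis .
  qed
  have bd_c: "q3 * (b * d + c) = s1 * ((d - 2) * (d + 4) * (- 2 * s1^2 + 2 * d * s2))"
  proof -
    have "q3 * (b * d + c) = d / 3 * (q3 * (3 * b)) + q3 * c"
      by (simp add: algebra_simps)
    also have "\<dots> = s1 * ((d - 2) * (d + 4) * (- 2 * s1^2 + 2 * d * s2))"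
      unfolding sol by (simp add: field_simps power2_eq_square power3_eq_cube)
    finally show ?thesis .
  qed
  have coeff: "q2 * (a * d + 2 * b) = s1 * ((d + 1) * s1^2 - 2 * s2)"
    "q2 * (b * d + c) = s1 * (- 2 * s1^2 + 2 * d * s2)"
  proof -
    have cancel: "q2 * A = s1 * B" if "q3 * A = s1 * ((d - 2) * (d + 4) * B)" for A B
    proof -
      have "((d - 2) * (d + 4)) * (q2 * A) = ((d - 2) * (d + 4)) * (s1 * B)"
        using that unfolding q(3) by (simp only: mult_ac)
      moreover have "(d - 2) * (d + 4) \<noteq> 0" using \<open>d \<ge> 3\<close> by auto
      ultimately show ?thesis using mult_left_cancel by blast
    qed
    show "q2 * (a * d + 2 * b) = s1 * ((d + 1) * s1^2 - 2 * s2)"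
      "q2 * (b * d + c) = s1 * (- 2 * s1^2 + 2 * d * s2)"
      by (rule cancel[OF ad_b], rule cancel[OF bd_c])
  qed
  have second: "cross_moment H lam [X, Y] = 1 / q2 *
      (((d + 1) * s1^2 - 2 * s2) * trace X * trace Y + (- 2 * s1^2 + 2 * d * s2) * trace (X ** Y))"
    if "X \<in> symmetric_matrices" "Y \<in> symmetric_matrices" for X Y
  proof -
    have "s1 * (q2 * cross_moment H lam [X, Y]) =
        s1 * (((d + 1) * s1^2 - 2 * s2) * trace X * trace Y + (- 2 * s1^2 + 2 * d * s2) * trace (X ** Y))"
    proof -
      have "s1 * (q2 * cross_moment H lam [X, Y]) = q2 * (s1 * cross_moment H lam [X, Y])" by simp
      also have "\<dots> = (q2 * (a * d + 2 * b)) * trace X * trace Y + (q2 * (b * d + c)) * trace (X ** Y)"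
        unfolding degree2[OF that] by (simp add: algebra_simps)
      finally show ?thesis unfolding coeff by (simp add: algebra_simps)
    qed
    then have "q2 * cross_moment H lam [X, Y] =
        ((d + 1) * s1^2 - 2 * s2) * trace X * trace Y + (- 2 * s1^2 + 2 * d * s2) * trace (X ** Y)"
      using \<open>s1 > 0\<close> mult_left_cancel[of s1] by blast
    then show ?thesis using q(1) by (metis nonzero_mult_div_cancel_left times_divide_eq_left mult_1)
  qed
  have "s1 * cross_moment H lam [X1] = cross_moment H lam [X1, ?I]"
    using cross_moment_perm[OF H, of "[X1, ?I]" "[?I, X1]" lam]
    by (simp add: cross_moment_mat_1_Cons[OF H] s1_def)
  also have "\<dots> = s1 * (s1 * trace X1 / d)"
  proof -
    have "q2 * cross_moment H lam [X1, ?I] =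
        ((d + 1) * s1^2 - 2 * s2) * trace X1 * d + (- 2 * s1^2 + 2 * d * s2) * trace X1"
      unfolding second[OF sym(1) mat_1_in_symmetric_matrices] using q(1) by (simp add: trace_I d_def)
    also have "\<dots> = (d - 1) * (d + 2) * s1^2 * trace X1" by algebra
    also have "\<dots> = q2 * (s1 * (s1 * trace X1 / d))"
      using \<open>d \<ge> 3\<close> by (simp add: q2_def power2_eq_square)
    finally show ?thesis using q(1) mult_left_cancel[of q2] by blast
  qed
  finally have "cross_moment H lam [X1] = s1 * trace X1 / d"
    using \<open>s1 > 0\<close> mult_left_cancel[of s1] by blast
  then have first: "cross_moment H lam [X1] = 1 / d * (s1 * trace X1)"
    by simp
  show ?thesis
    unfolding Let_def defs q2_def[symmetric] q3_def[symmetric]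
    using first second[OF sym(1,2)] third by blast
qed

end
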